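(* Let $j,m$ be positive integers, $\tau_{j,m}=\frac{j+\sqrt{j^2+4m}}{2}$, and $M\in M_2(\mathbb{Z})$. (a) If $j^2+4m$ is not a perfect square, then $[\tau_{j,m}\ 1]^T$ is a right eigenvector of $M$ if and only if there exist integers $s,t$ with $M=\begin{bmatrix} t+sj & ms\\ s & t\end{bmatrix}$. (b) If $j^2+4m=r^2$ for some positive integer $r$, then $[\tau_{j,m}\ 1]^T$ is a right eigenvector of $M$ if and only if $M=\begin{bmatrix} s & t\\ u & v\end{bmatrix}$ with integers $s,t,u,v$ satisfying $u(j+r)^2+2(v-s)(j+r)-4t=0$. *)

theory Defs
  imports
    Complex_Main
    "Jordan_Normal_Form.Char_Poly"
    "HOL-Computational_Algebra.Nth_Powers"
begin

definition tau :: "int \<Rightarrow> int \<Rightarrow> real" where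
  "tau j m = (real_of_int j + sqrt (real_of_int (j\<^sup>2 + 4 * m))) / 2"

definition right_eigenvector :: "'a :: comm_ring_1 mat \<Rightarrow> 'a vec \<Rightarrow> bool" where
  "right_eigenvector A v \<longleftrightarrow> (\<exists>k. eigenvector A v k)"

end

theory Submission
  imports Defs
begin

text \<open>Write M with rows (a, b) and (c, d). The second coordinate of the vector (x, 1) forces
  the eigenvalue to be c x + d, so (x, 1) is an eigenvector exactly when c x^2 + (d - a) x - b = 0
  (\<open>right_eigenvector_2_iff\<close>). For x = \<tau>, substitute \<tau>^2 = j \<tau> + m
  (\<open>tau_power2\<close>) to get (c j + d - a) \<tau> + (c m - b) = 0. If j^2 + 4m is not a
  square, 1 and \<tau> are linearly independent over the integers (\<open>tau_linear_eq_0\<close>),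
  so both coefficients vanish; this is the stated family with s = c and t = d. If j^2 + 4m = r^2,
  then \<tau> = (j + r)/2 is rational, and clearing denominators in the quadratic gives the stated
  integer equation.\<close>

lemma mat_2_eq_iff:
  fixes M :: "'a mat"
  assumes "M \<in> carrier_mat 2 2"
  shows "M = mat_of_rows_list 2 [[a, b], [c, d]] \<longleftrightarrow>
    M $$ (0, 0) = a \<and> M $$ (0, 1) = b \<and> M $$ (1, 0) = c \<and> M $$ (1, 1) = d"
  using assms
  by (auto simp: mat_eq_iff mat_of_rows_list_def numeral_2_eq_2 less_Suc_eq)

lemma right_eigenvector_2_iff:
  fixes A :: "'a :: comm_ring_1 mat"
  assumes A: "A \<in> carrier_mat 2 2"
  shows "right_eigenvector A (vec_of_list [x, 1]) \<longleftrightarrow>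
    A $$ (1, 0) * x\<^sup>2 + (A $$ (1, 1) - A $$ (0, 0)) * x - A $$ (0, 1) = 0"
proof -
  let ?v = "vec_of_list [x, 1]"
  have dim: "dim_row A = 2" "dim_col A = 2" using A by auto
  have v: "?v \<in> carrier_vec 2" by (rule carrier_vecI) simp
  \<comment> \<open>The last entry is 1, which differs from 0 in any \<open>comm_ring_1\<close>, so
    the eigenvector condition reduces to the matrix equation.\<close>
  have nz: "?v \<noteq> 0\<^sub>v 2"
  proof
    assume "?v = 0\<^sub>v 2"
    hence "?v $ 1 = 0\<^sub>v 2 $ 1" by simp
    thus False by simp
  qed
  have prod: "A *\<^sub>v ?v = k \<cdot>\<^sub>v ?v \<longleftrightarrow>
      A $$ (0, 0) * x + A $$ (0, 1) = k * x \<and> A $$ (1, 0) * x + A $$ (1, 1) = k" for k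
    using dim
    by (auto simp: vec_eq_iff scalar_prod_def numeral_2_eq_2 less_Suc_eq)
  have "right_eigenvector A ?v \<longleftrightarrow> (\<exists>k. A *\<^sub>v ?v = k \<cdot>\<^sub>v ?v)"
    unfolding right_eigenvector_def eigenvector_def dim
    using nz v by blast
  also have "\<dots> \<longleftrightarrow>
      A $$ (0, 0) * x + A $$ (0, 1) = (A $$ (1, 0) * x + A $$ (1, 1)) * x"
    unfolding prod by auto
  also have "\<dots> \<longleftrightarrow>
      A $$ (1, 0) * x\<^sup>2 + (A $$ (1, 1) - A $$ (0, 0)) * x - A $$ (0, 1) = 0"
    by (auto simp: algebra_simps power2_eq_square)
  finally show ?thesis .
qed

text \<open>Nonnegativity of the discriminant lets squaring undo \<open>sqrt\<close>, which for a
  negative argument returns a negative real.\<close>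

lemma tau_power2:
  assumes "j\<^sup>2 + 4 * m \<ge> 0"
  shows "(tau j m)\<^sup>2 = of_int j * tau j m + of_int m"
proof -
  define S where "S = sqrt (real_of_int (j\<^sup>2 + 4 * m))"
  have "S\<^sup>2 = real_of_int (j\<^sup>2 + 4 * m)"
    unfolding S_def by (rule real_sqrt_pow2) (use assms in linarith)
  hence "S\<^sup>2 = (of_int j)\<^sup>2 + 4 * of_int m" by simp
  moreover have tau: "tau j m = (of_int j + S) / 2" by (simp add: tau_def S_def)
  ultimately show ?thesis unfolding tau by (simp add: field_simps power2_eq_square)
qed

text \<open>A nontrivial relation would make the square root of the discriminant rational. Isolating
  the root and squaring turns this into a divisibility argument over the integers.\<close>

lemma tau_linear_eq_0:
  fixes x y :: int
  assumes nsq: "\<not> is_square (j\<^sup>2 + 4 * m)" and "j\<^sup>2 + 4 * m \<ge> 0"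
    and eq: "of_int x * tau j m + of_int y = 0"
  shows "x = 0 \<and> y = 0"
proof (cases "x = 0")
  case False
  let ?D = "j\<^sup>2 + 4 * m"
  have S: "(sqrt (real_of_int ?D))\<^sup>2 = real_of_int ?D"
    by (rule real_sqrt_pow2) (use assms in linarith)
  have "of_int x * sqrt (real_of_int ?D) = - of_int (2 * y + x * j)"
    using eq by (simp add: tau_def field_simps)
  hence "(of_int x * sqrt (real_of_int ?D))\<^sup>2 = (of_int (2 * y + x * j))\<^sup>2"
    by (simp only: power2_minus)
  hence "real_of_int (x\<^sup>2 * ?D) = real_of_int ((2 * y + x * j)\<^sup>2)"
    unfolding power_mult_distrib S by (simp only: of_int_mult of_int_power)
  hence D: "x\<^sup>2 * ?D = (2 * y + x * j)\<^sup>2" by (simp only: of_int_eq_iff)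
  \<comment> \<open>Divisibility of squares descends to x itself, so the rational root (2y + xj)/x
    is, up to sign, an integer z, and cancelling x^2 exhibits the discriminant as z^2.\<close>
  hence "x\<^sup>2 dvd (2 * y + x * j)\<^sup>2" by (metis dvd_triv_left)
  hence "x dvd 2 * y + x * j" by (simp only: pow_divides_pow_iff zero_less_numeral)
  then obtain z where "2 * y + x * j = x * z" by (elim dvdE)
  hence "?D = z\<^sup>2" using D False by (simp add: power_mult_distrib)
  thus ?thesis using nsq by (metis is_nth_powerI)
qed (use eq in simp)

theorem theorem4p26:
  fixes j m :: int and M :: "int mat"
  assumes "j > 0" and "m > 0" and "M \<in> carrier_mat 2 2"
  shows "(\<not> is_square (j\<^sup>2 + 4 * m) \<longrightarrow>
      (right_eigenvector (map_mat real_of_int M) (vec_of_list [tau j m, 1]) \<longleftrightarrow>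
       (\<exists>s t :: int. M = mat_of_rows_list 2 [[t + s * j, m * s], [s, t]])))
    \<and> (\<forall>r :: int. r > 0 \<and> j\<^sup>2 + 4 * m = r\<^sup>2 \<longrightarrow>
      (right_eigenvector (map_mat real_of_int M) (vec_of_list [tau j m, 1]) \<longleftrightarrow>
       (\<exists>s t u v :: int. M = mat_of_rows_list 2 [[s, t], [u, v]] \<and>
          u * (j + r)\<^sup>2 + 2 * (v - s) * (j + r) - 4 * t = 0)))"
proof -
  define a b c d where abcd: "a = M $$ (0, 0)" "b = M $$ (0, 1)"
    "c = M $$ (1, 0)" "d = M $$ (1, 1)"
  let ?E = "right_eigenvector (map_mat real_of_int M) (vec_of_list [tau j m, 1])"
  have D: "j\<^sup>2 + 4 * m \<ge> 0" using assms by simp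
  have "map_mat real_of_int M \<in> carrier_mat 2 2" using assms by simp
  from right_eigenvector_2_iff[OF this]
  have eigen: "?E \<longleftrightarrow> of_int c * (tau j m)\<^sup>2 + (of_int d - of_int a) * tau j m - of_int b = 0"
    using assms by (simp add: abcd)
  have M: "M = mat_of_rows_list 2 [[s, t], [u, v]] \<longleftrightarrow> a = s \<and> b = t \<and> c = u \<and> d = v"
    for s t u v
    using mat_2_eq_iff[OF assms(3)] by (simp add: abcd)
  have "?E \<longleftrightarrow> (\<exists>s t. M = mat_of_rows_list 2 [[t + s * j, m * s], [s, t]])"
    if nsq: "\<not> is_square (j\<^sup>2 + 4 * m)"
  proof -
    have "?E \<longleftrightarrow> of_int (c * j + d - a) * tau j m + of_int (c * m - b) = 0"
      unfolding eigen tau_power2[OF D] by (simp add: algebra_simps)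
    also have "\<dots> \<longleftrightarrow> c * j + d - a = 0 \<and> c * m - b = 0"
      using tau_linear_eq_0[OF nsq D] by (metis add.right_neutral mult_zero_left of_int_0)
    \<comment> \<open>The bottom row fixes s = c and t = d; the two equations then determine a and
      b.\<close>
    also have "\<dots> \<longleftrightarrow> (\<exists>s t. M = mat_of_rows_list 2 [[t + s * j, m * s], [s, t]])"
      unfolding M by (auto simp: algebra_simps)
    finally show ?thesis .
  qed
  moreover have "?E \<longleftrightarrow> (\<exists>s t u v. M = mat_of_rows_list 2 [[s, t], [u, v]] \<and>
      u * (j + r)\<^sup>2 + 2 * (v - s) * (j + r) - 4 * t = 0)"
    if r: "r > 0" "j\<^sup>2 + 4 * m = r\<^sup>2" for r
  proof -
    have tau: "tau j m = of_int (j + r) / 2" using r by (simp add: tau_def)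
    \<comment> \<open>The quadratic at (j + r)/2 is multiplied by 4. Keeping both sides as casts of
      integers lets \<open>of_int_eq_iff\<close> bring the equation back to the integers.\<close>
    have "?E \<longleftrightarrow>
        real_of_int (c * (j + r)\<^sup>2 + 2 * (d - a) * (j + r) - 4 * b) = real_of_int 0"
      unfolding eigen unfolding tau by (auto simp: field_simps power2_eq_square)
    thus ?thesis unfolding of_int_eq_iff M by auto
  qed
  ultimately show ?thesis by blast
qed

end
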